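(* Let $(G,<)$ be a Latin instance of the stable marriage problem. Then $G_L=G$. Moreover, if $(G,<)$ has $n$ men and $n$ women, then there exists an instance $(G',<')$ with one additional man $\tilde a$ and one additional woman $\tilde b$ such that $|\mathcal{S}(G',<')|=1$ and $\mathcal{L}(G',<')=\{M\cup\{\tilde a\tilde b\}: M\in\mathcal{S}(G,<)\}$.
   Context: An instance of the stable marriage problem is $(G,<)$ with $G=(A\cup B,E)$ a finite simple bipartite graph (men $A$, women $B$) and $<_v$ a strict total order on the neighbours of each vertex $v$ (write $y>_x y'$, and $y>_x\emptyset$ for each neighbour $y$). A matching $M\subseteq E$ has each vertex in at most one edge; $M(x)$ is the partner of $x$ or $\emptyset$. Edge $ab$ blocks $M$ if $b>_a M(a)$ and $a>_b M(b)$; a matching blocks $M$ if one of its edges does; $M$ is stable if no edge of $G$ blocks it; $\mathcal{S}(G,<)$ is the set of stable matchings. A set $\mathcal{L}$ of matchings has the legal property if the matchings blocked by some member of $\mathcal{L}$ are exactly those not in $\mathcal{L}$; there is exactly one such set, denoted $\mathcal{L}(G,<)$ (legal matchings). $G_L$ is the subgraph of $G$ whose edges are those lying in some legal matching. For an instance with complete lists ($G$ complete bipartite, $|A|=|B|=n$), the rank of $a$ in $b$'s list is its position (1 = most preferred). $(G,<)$ is Latin if there is an $n\times n$ Latin square $Q$ (each row and column a permutation of $1,\dots,n$), rows indexed by $A$ and columns by $B$, such that for every $a,b$, $Q(a,b)$ is the rank of $b$ in $a$'s list and $n+1-Q(a,b)$ is the rank of $a$ in $b$'s list. *)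

theory Defs
  imports Main
begin

text \<open>Men and women are taken from two separate types, so an edge is a pair (man, woman) and the
  graph is automatically simple and bipartite.\<close>

record ('a, 'b) bigraph =
  men :: "'a set"
  women :: "'b set"
  edges :: "('a \<times> 'b) set"

text \<open>The pair \<open>(y', y)\<close> belongs to the relation of \<open>x\<close> iff \<open>y' <\<^sub>x y\<close>, i.e. \<open>x\<close> strictly prefers
  \<open>y\<close> to \<open>y'\<close>.\<close>

record ('a, 'b) prefs =
  man_less :: "'a \<Rightarrow> ('b \<times> 'b) set"
  woman_less :: "'b \<Rightarrow> ('a \<times> 'a) set"

definition man_nbrs :: "('a, 'b) bigraph \<Rightarrow> 'a \<Rightarrow> 'b set" where
  "man_nbrs G a = {b. (a, b) \<in> edges G}"

definition woman_nbrs :: "('a, 'b) bigraph \<Rightarrow> 'b \<Rightarrow> 'a set" where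
  "woman_nbrs G b = {a. (a, b) \<in> edges G}"

definition finite_bigraph :: "('a, 'b) bigraph \<Rightarrow> bool" where
  "finite_bigraph G \<longleftrightarrow>
     finite (men G) \<and> finite (women G) \<and> edges G \<subseteq> men G \<times> women G"

text \<open>The library predicate \<^const>\<open>strict_linear_order_on\<close> does not confine the relation to the
  given set; hence the explicit inclusions.\<close>

definition sm_instance :: "('a, 'b) bigraph \<Rightarrow> ('a, 'b) prefs \<Rightarrow> bool" where
  "sm_instance G P \<longleftrightarrow> finite_bigraph G \<and>
     (\<forall>a\<in>men G. man_less P a \<subseteq> man_nbrs G a \<times> man_nbrs G a \<and>
        strict_linear_order_on (man_nbrs G a) (man_less P a)) \<and>
     (\<forall>b\<in>women G. woman_less P b \<subseteq> woman_nbrs G b \<times> woman_nbrs G b \<and>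
        strict_linear_order_on (woman_nbrs G b) (woman_less P b))"

definition matching :: "('a, 'b) bigraph \<Rightarrow> ('a \<times> 'b) set \<Rightarrow> bool" where
  "matching G M \<longleftrightarrow> M \<subseteq> edges G \<and>
     (\<forall>a b b'. (a, b) \<in> M \<longrightarrow> (a, b') \<in> M \<longrightarrow> b = b') \<and>
     (\<forall>a a' b. (a, b) \<in> M \<longrightarrow> (a', b) \<in> M \<longrightarrow> a = a')"

definition man_partner :: "('a \<times> 'b) set \<Rightarrow> 'a \<Rightarrow> 'b option" where
  "man_partner M a = (if \<exists>b. (a, b) \<in> M then Some (THE b. (a, b) \<in> M) else None)"

definition woman_partner :: "('a \<times> 'b) set \<Rightarrow> 'b \<Rightarrow> 'a option" where
  "woman_partner M b = (if \<exists>a. (a, b) \<in> M then Some (THE a. (a, b) \<in> M) else None)"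

text \<open>The value \<^const>\<open>None\<close> plays the role of \<open>\<emptyset>\<close>, which is worse than every neighbour.\<close>

definition man_prefers ::
  "('a, 'b) bigraph \<Rightarrow> ('a, 'b) prefs \<Rightarrow> 'a \<Rightarrow> 'b \<Rightarrow> 'b option \<Rightarrow> bool" where
  "man_prefers G P a y z =
     (case z of None \<Rightarrow> y \<in> man_nbrs G a | Some y' \<Rightarrow> (y', y) \<in> man_less P a)"

definition woman_prefers ::
  "('a, 'b) bigraph \<Rightarrow> ('a, 'b) prefs \<Rightarrow> 'b \<Rightarrow> 'a \<Rightarrow> 'a option \<Rightarrow> bool" where
  "woman_prefers G P b x z =
     (case z of None \<Rightarrow> x \<in> woman_nbrs G b | Some x' \<Rightarrow> (x', x) \<in> woman_less P b)"

definition edge_blocks ::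
  "('a, 'b) bigraph \<Rightarrow> ('a, 'b) prefs \<Rightarrow> 'a \<times> 'b \<Rightarrow> ('a \<times> 'b) set \<Rightarrow> bool" where
  "edge_blocks G P e M \<longleftrightarrow> e \<in> edges G \<and>
     man_prefers G P (fst e) (snd e) (man_partner M (fst e)) \<and>
     woman_prefers G P (snd e) (fst e) (woman_partner M (snd e))"

definition matching_blocks ::
  "('a, 'b) bigraph \<Rightarrow> ('a, 'b) prefs \<Rightarrow> ('a \<times> 'b) set \<Rightarrow> ('a \<times> 'b) set \<Rightarrow> bool" where
  "matching_blocks G P N M \<longleftrightarrow> (\<exists>e\<in>N. edge_blocks G P e M)"

definition stable_matchings ::
  "('a, 'b) bigraph \<Rightarrow> ('a, 'b) prefs \<Rightarrow> ('a \<times> 'b) set set" where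
  "stable_matchings G P = {M. matching G M \<and> (\<forall>e\<in>edges G. \<not> edge_blocks G P e M)}"

definition legal_property ::
  "('a, 'b) bigraph \<Rightarrow> ('a, 'b) prefs \<Rightarrow> ('a \<times> 'b) set set \<Rightarrow> bool" where
  "legal_property G P L \<longleftrightarrow> L \<subseteq> {M. matching G M} \<and>
     {M. matching G M \<and> (\<exists>N\<in>L. matching_blocks G P N M)} = {M. matching G M} - L"

definition legal_matchings ::
  "('a, 'b) bigraph \<Rightarrow> ('a, 'b) prefs \<Rightarrow> ('a \<times> 'b) set set" where
  "legal_matchings G P = (THE L. legal_property G P L)"

definition legal_subgraph ::
  "('a, 'b) bigraph \<Rightarrow> ('a, 'b) prefs \<Rightarrow> ('a, 'b) bigraph" where
  "legal_subgraph G P =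
     G\<lparr>edges := {e \<in> edges G. \<exists>M\<in>legal_matchings G P. e \<in> M}\<rparr>"

definition man_rank :: "('a, 'b) prefs \<Rightarrow> 'a \<Rightarrow> 'b \<Rightarrow> nat" where
  "man_rank P a b = card {y. (b, y) \<in> man_less P a} + 1"

definition woman_rank :: "('a, 'b) prefs \<Rightarrow> 'b \<Rightarrow> 'a \<Rightarrow> nat" where
  "woman_rank P b a = card {x. (a, x) \<in> woman_less P b} + 1"

definition complete_lists :: "('a, 'b) bigraph \<Rightarrow> bool" where
  "complete_lists G \<longleftrightarrow> edges G = men G \<times> women G \<and> card (men G) = card (women G)"

definition latin_square :: "'a set \<Rightarrow> 'b set \<Rightarrow> nat \<Rightarrow> ('a \<Rightarrow> 'b \<Rightarrow> nat) \<Rightarrow> bool" where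
  "latin_square A B n Q \<longleftrightarrow> card A = n \<and> card B = n \<and>
     (\<forall>a\<in>A. bij_betw (\<lambda>b. Q a b) B {1..n}) \<and>
     (\<forall>b\<in>B. bij_betw (\<lambda>a. Q a b) A {1..n})"

definition latin_instance :: "('a, 'b) bigraph \<Rightarrow> ('a, 'b) prefs \<Rightarrow> nat \<Rightarrow> bool" where
  "latin_instance G P n \<longleftrightarrow> sm_instance G P \<and> complete_lists G \<and>
     (\<exists>Q. latin_square (men G) (women G) n Q \<and>
        (\<forall>a\<in>men G. \<forall>b\<in>women G.
           man_rank P a b = Q a b \<and> woman_rank P b a = n + 1 - Q a b))"

text \<open>The new man and the new woman are both represented by \<^const>\<open>None\<close>, while an old vertex \<open>v\<close>
  becomes \<open>Some v\<close>; this guarantees that the new vertices are fresh. The original instance is the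
  one induced on the old vertices.\<close>

definition adds_man_and_woman ::
  "('a, 'b) bigraph \<Rightarrow> ('a, 'b) prefs \<Rightarrow>
   ('a option, 'b option) bigraph \<Rightarrow> ('a option, 'b option) prefs \<Rightarrow> bool" where
  "adds_man_and_woman G P G' P' \<longleftrightarrow>
     men G' = insert None (Some ` men G) \<and>
     women G' = insert None (Some ` women G) \<and>
     (\<forall>a b. (Some a, Some b) \<in> edges G' \<longleftrightarrow> (a, b) \<in> edges G) \<and>
     (\<forall>a\<in>men G. \<forall>y y'. (Some y', Some y) \<in> man_less P' (Some a) \<longleftrightarrow> (y', y) \<in> man_less P a) \<and>
     (\<forall>b\<in>women G. \<forall>x x'. (Some x', Some x) \<in> woman_less P' (Some b) \<longleftrightarrow> (x', x) \<in> woman_less P b)"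

end

theory Submission
  imports Defs
begin

text \<open>The cells of the Latin square \<open>Q\<close> that contain \<open>k\<close> form a stable matching \<open>M\<^sub>k\<close>, because
  an edge can improve a man only if its entry is below \<open>k\<close> and a woman only if it is above \<open>k\<close>.
  So every edge lies in a stable matching, and therefore the legal matchings of \<open>(G, <)\<close> are just the
  stable ones.

  For the second part, the new woman \<open>b\<^sub>0\<close> is acceptable only to the new man \<open>a\<^sub>0\<close>, who likes
  her least among
  all women, and every old woman ranks the new man second. A matching not blocked by
  \<open>M\<^sub>n \<union> {(a\<^sub>0, b\<^sub>0)}\<close> must match all men, since in \<open>M\<^sub>n\<close> every woman has her favourite; hence it is
  perfect and contains \<open>(a\<^sub>0, b\<^sub>0)\<close>. Consequently the remaining edges at the new man
  are in no legal matching, and the legal matchings correspond to those of \<open>(G, <)\<close>. These edges do,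
  however, block each \<open>M \<union> {(a\<^sub>0, b\<^sub>0)}\<close> in which some woman lacks her favourite, so that only
  \<open>M\<^sub>n \<union> {(a\<^sub>0, b\<^sub>0)}\<close> is stable.\<close>

section \<open>Blocking and legality in arbitrary instances\<close>

text \<open>At an unmatched vertex the corresponding condition is vacuous, in agreement with
  \<open>None\<close> ranking below every neighbour. This keeps \<open>THE\<close> and partner
  options out of the later arguments.\<close>

lemma edge_blocks_matching_iff:
  assumes "matching G M"
  shows "edge_blocks G P (a, b) M \<longleftrightarrow> (a, b) \<in> edges G \<and>
    (\<forall>b'. (a, b') \<in> M \<longrightarrow> (b', b) \<in> man_less P a) \<and>
    (\<forall>a'. (a', b) \<in> M \<longrightarrow> (a', a) \<in> woman_less P b)"
proof -
  have "man_prefers G P a b (man_partner M a) \<longleftrightarrow> (\<forall>b'. (a, b') \<in> M \<longrightarrow> (b', b) \<in> man_less P a)"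
    if e: "(a, b) \<in> edges G"
  proof (cases "\<exists>b'. (a, b') \<in> M")
    case True
    then obtain b' where b': "(a, b') \<in> M" ..
    then have unique: "(a, y) \<in> M \<longleftrightarrow> y = b'" for y
      using assms unfolding matching_def by metis
    then have "man_partner M a = Some b'" by (simp add: man_partner_def)
    then show ?thesis by (simp add: man_prefers_def unique)
  next
    case False
    then show ?thesis using e by (auto simp: man_partner_def man_prefers_def man_nbrs_def)
  qed
  moreover have "woman_prefers G P b a (woman_partner M b) \<longleftrightarrow>
      (\<forall>a'. (a', b) \<in> M \<longrightarrow> (a', a) \<in> woman_less P b)"
    if e: "(a, b) \<in> edges G"
  proof (cases "\<exists>a'. (a', b) \<in> M")
    case True
    then obtain a' where a': "(a', b) \<in> M" ..
    then have unique: "(x, b) \<in> M \<longleftrightarrow> x = a'" for x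
      using assms unfolding matching_def by metis
    then have "woman_partner M b = Some a'" by (simp add: woman_partner_def)
    then show ?thesis by (simp add: woman_prefers_def unique)
  next
    case False
    then show ?thesis using e by (auto simp: woman_partner_def woman_prefers_def woman_nbrs_def)
  qed
  ultimately show ?thesis unfolding edge_blocks_def fst_conv snd_conv by blast
qed

lemma stable_matching_not_blocked:
  assumes "M \<in> stable_matchings G P" and "matching G N"
  shows "\<not> matching_blocks G P N M"
  using assms unfolding stable_matchings_def matching_blocks_def matching_def by blast

text \<open>No matching blocks a stable one, so no member of \<open>L\<close> does, and an unblocked
  matching cannot lie outside \<open>L\<close>.\<close>

lemma stable_matchings_subset_legal:
  assumes "legal_property G P L"
  shows "stable_matchings G P \<subseteq> L"
proof
  fix M assume M: "M \<in> stable_matchings G P"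
  then have "matching G M" by (simp add: stable_matchings_def)
  moreover have "\<not> (\<exists>N\<in>L. matching_blocks G P N M)"
    using assms M stable_matching_not_blocked unfolding legal_property_def by blast
  ultimately show "M \<in> L" using assms unfolding legal_property_def by blast
qed

text \<open>Every legal set contains \<open>S\<close>, so its members are not blocked by \<open>S\<close>; by \<open>undominated\<close> they
  cannot block a member of \<open>K\<close>, and \<open>dominating\<close> leaves no room for anything else.\<close>

lemma legal_matchings_eqI:
  assumes K: "K \<subseteq> {M. matching G M}"
    and S: "S \<subseteq> stable_matchings G P" "S \<subseteq> K"
    and undominated: "\<And>M N. \<lbrakk>M \<in> K; matching G N; \<And>R. R \<in> S \<Longrightarrow> \<not> matching_blocks G P R N\<rbrakk>
      \<Longrightarrow> \<not> matching_blocks G P N M"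
    and dominating: "\<And>M. \<lbrakk>matching G M; M \<notin> K\<rbrakk> \<Longrightarrow> \<exists>N\<in>K. matching_blocks G P N M"
  shows "legal_matchings G P = K"
  unfolding legal_matchings_def
proof (rule the_equality)
  have K_matching: "matching G M" if "M \<in> K" for M using K that by auto
  \<comment> \<open>A stable \<open>R\<close> in \<open>S\<close> is itself not blocked by
    \<open>S\<close>, so \<open>undominated\<close> applies to it.\<close>
  have S_K: "\<not> matching_blocks G P R N" if R: "R \<in> S" and N: "N \<in> K" for R N
  proof (rule undominated[OF N])
    show "matching G R" using R S(2) K_matching by auto
    fix R' assume "R' \<in> S"
    then have "matching G R'" using S(2) K_matching by auto
    then show "\<not> matching_blocks G P R' R"
      using stable_matching_not_blocked R S(1) by (metis subsetD)
  qed
  \<comment> \<open>By \<open>S_K\<close> the members of \<open>K\<close> are not blocked by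
    \<open>S\<close>, so \<open>undominated\<close> applies to them in turn.\<close>
  have "\<not> matching_blocks G P N M" if M: "M \<in> K" and N: "N \<in> K" for M N
  proof (rule undominated[OF M K_matching[OF N]])
    show "\<not> matching_blocks G P R N" if "R \<in> S" for R using S_K[OF that N] .
  qed
  then show "legal_property G P K"
    using K dominating unfolding legal_property_def by auto
next
  fix L assume L: "legal_property G P L"
  then have S_L: "S \<subseteq> L" using S(1) stable_matchings_subset_legal by (metis subset_trans)
  have L_matching: "matching G M" if "M \<in> L" for M
    using L that unfolding legal_property_def by auto
  have L_iff: "M \<in> L \<longleftrightarrow> (\<forall>N\<in>L. \<not> matching_blocks G P N M)" if "matching G M" for M
    using L that unfolding legal_property_def set_eq_iff by auto
  have "M \<in> L" if M: "M \<in> K" for M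
  proof -
    have "\<not> matching_blocks G P N M" if N: "N \<in> L" for N
    proof (rule undominated[OF M L_matching[OF N]])
      show "\<not> matching_blocks G P R N" if "R \<in> S" for R
        using that S_L N L_iff[OF L_matching[OF N]] by auto
    qed
    moreover have "matching G M" using M K by auto
    ultimately show ?thesis using L_iff by simp
  qed
  moreover have "M \<in> K" if M: "M \<in> L" for M
  proof (rule ccontr)
    assume "M \<notin> K"
    then obtain N where "N \<in> K" "matching_blocks G P N M"
      using dominating[OF L_matching[OF M]] by auto
    then show False using M L_iff[OF L_matching[OF M]] \<open>\<And>M. M \<in> K \<Longrightarrow> M \<in> L\<close> by simp
  qed
  ultimately show "L = K" by auto
qed

section \<open>Finite strict orders, ranks and weights\<close>

text \<open>By transitivity and irreflexivity, moving up strictly shrinks the set of better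
  elements; totality gives the converse.\<close>

lemma strict_linear_order_on_rank_iff:
  assumes "finite A" and "r \<subseteq> A \<times> A" and "strict_linear_order_on A r"
    and "x \<in> A" and "y \<in> A"
  shows "(x, y) \<in> r \<longleftrightarrow> card {z. (y, z) \<in> r} < card {z. (x, z) \<in> r}"
proof -
  have r: "trans r" "irrefl r" "total_on A r"
    using assms(3) by (auto simp: strict_linear_order_on_def)
  have less: "card {z. (v, z) \<in> r} < card {z. (u, z) \<in> r}" if "(u, v) \<in> r" for u v
  proof (rule psubset_card_mono)
    show "finite {z. (u, z) \<in> r}" using assms(1,2) by (auto intro: finite_subset)
    show "{z. (v, z) \<in> r} \<subset> {z. (u, z) \<in> r}"
      using r(1,2) that by (auto simp: irrefl_def dest: transD)
  qed
  show ?thesis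
    using less[of x y] less[of y x] r(3) assms(4,5)
    by (metis less_irrefl less_asym total_on_def)
qed

lemma strict_linear_order_on_weight:
  fixes f :: "'a \<Rightarrow> nat"
  assumes "inj_on f A"
  shows "strict_linear_order_on A {(x, y). x \<in> A \<and> y \<in> A \<and> f x < f y}"
  using assms
  by (auto simp: strict_linear_order_on_def trans_def irrefl_def total_on_def inj_on_def)
    (metis nat_neq_iff)

section \<open>Latin instances and the levels of the square\<close>

locale latin_setup =
  fixes G :: "('a, 'b) bigraph" and P :: "('a, 'b) prefs" and n :: nat and Q :: "'a \<Rightarrow> 'b \<Rightarrow> nat"
  assumes sm: "sm_instance G P"
    and complete: "complete_lists G"
    and square: "latin_square (men G) (women G) n Q"
    and ranks: "\<And>a b. \<lbrakk>a \<in> men G; b \<in> women G\<rbrakk>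
      \<Longrightarrow> man_rank P a b = Q a b \<and> woman_rank P b a = n + 1 - Q a b"
begin

lemma edges_eq: "edges G = men G \<times> women G"
  using complete by (simp add: complete_lists_def)

lemma finite_men: "finite (men G)" and finite_women: "finite (women G)"
  using sm by (auto simp: sm_instance_def finite_bigraph_def)

lemma man_nbrs_eq: "a \<in> men G \<Longrightarrow> man_nbrs G a = women G"
  and woman_nbrs_eq: "b \<in> women G \<Longrightarrow> woman_nbrs G b = men G"
  by (auto simp: man_nbrs_def woman_nbrs_def edges_eq)

lemma inj_on_row: "a \<in> men G \<Longrightarrow> inj_on (Q a) (women G)"
  and inj_on_column: "b \<in> women G \<Longrightarrow> inj_on (\<lambda>a. Q a b) (men G)"
  and row_image: "a \<in> men G \<Longrightarrow> Q a ` women G = {1..n}"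
  and column_image: "b \<in> women G \<Longrightarrow> (\<lambda>a. Q a b) ` men G = {1..n}"
  using square by (auto simp: latin_square_def bij_betw_def)

lemma entry_bounds:
  assumes "a \<in> men G" and "b \<in> women G"
  shows "1 \<le> Q a b" and "Q a b \<le> n"
  using row_image[OF assms(1)] assms(2) by (auto simp: set_eq_iff image_iff)

text \<open>A single vertex on either side forces \<open>n\<close> to be positive; in the empty
  instance \<open>{1..n}\<close> is empty.\<close>

lemma top_entry: "a \<in> men G \<Longrightarrow> n \<in> {1..n}" "b \<in> women G \<Longrightarrow> n \<in> {1..n}"
proof -
  have "card (men G) = n" "card (women G) = n" using square by (simp_all add: latin_square_def)
  then have "n \<noteq> 0" if "men G \<noteq> {} \<or> women G \<noteq> {}"
    using that finite_men finite_women card_eq_0_iff by metis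
  then show "a \<in> men G \<Longrightarrow> n \<in> {1..n}" "b \<in> women G \<Longrightarrow> n \<in> {1..n}" by force+
qed

lemma man_less_iff:
  assumes a: "a \<in> men G"
  shows "(y', y) \<in> man_less P a \<longleftrightarrow> y' \<in> women G \<and> y \<in> women G \<and> Q a y < Q a y'"
proof -
  have r: "man_less P a \<subseteq> women G \<times> women G" "strict_linear_order_on (women G) (man_less P a)"
    using sm a by (auto simp: sm_instance_def man_nbrs_eq)
  have "(y', y) \<in> man_less P a \<longleftrightarrow> man_rank P a y < man_rank P a y'"
    if "y' \<in> women G" "y \<in> women G"
    using strict_linear_order_on_rank_iff[OF finite_women r that] by (simp add: man_rank_def)
  then show ?thesis using r(1) ranks a by auto
qed

lemma woman_less_iff:
  assumes b: "b \<in> women G"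
  shows "(x', x) \<in> woman_less P b \<longleftrightarrow> x' \<in> men G \<and> x \<in> men G \<and> Q x' b < Q x b"
proof -
  have r: "woman_less P b \<subseteq> men G \<times> men G" "strict_linear_order_on (men G) (woman_less P b)"
    using sm b by (auto simp: sm_instance_def woman_nbrs_eq)
  have "(x', x) \<in> woman_less P b \<longleftrightarrow> Q x' b < Q x b" if x: "x' \<in> men G" "x \<in> men G"
  proof -
    have "(x', x) \<in> woman_less P b \<longleftrightarrow> woman_rank P b x < woman_rank P b x'"
      using strict_linear_order_on_rank_iff[OF finite_men r x] by (simp add: woman_rank_def)
    \<comment> \<open>Entries are at most \<open>n\<close>, so \<open>n + 1 - Q x b\<close> is never
      truncated and reverses the order.\<close>
    then show ?thesis
      using ranks[OF x(1) b] ranks[OF x(2) b] entry_bounds[OF x(1) b] entry_bounds[OF x(2) b] by auto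
  qed
  then show ?thesis using r(1) by auto
qed

text \<open>For \<open>k\<close> in \<open>{1..n}\<close> this is the permutation traced by the
  symbol \<open>k\<close>; for other \<open>k\<close> it is empty.\<close>

definition level :: "nat \<Rightarrow> ('a \<times> 'b) set" where
  "level k = {(a, b). a \<in> men G \<and> b \<in> women G \<and> Q a b = k}"

lemma level_matching: "matching G (level k)"
  using inj_on_row inj_on_column
  by (auto simp: matching_def level_def edges_eq inj_on_def)

lemma level_covers_man:
  assumes "a \<in> men G" and "k \<in> {1..n}"
  obtains b where "(a, b) \<in> level k"
proof -
  have "k \<in> Q a ` women G" using row_image assms by blast
  then show thesis using that assms(1) by (auto simp: level_def)
qed

lemma level_covers_woman:
  assumes "b \<in> women G" and "k \<in> {1..n}"
  obtains a where "(a, b) \<in> level k"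
proof -
  have "k \<in> (\<lambda>a. Q a b) ` men G" using column_image assms by blast
  then show thesis using that assms(1) by (auto simp: level_def)
qed

lemma level_stable:
  assumes k: "k \<in> {1..n}"
  shows "level k \<in> stable_matchings G P"
proof -
  have False if block: "edge_blocks G P (a, b) (level k)" for a b
  proof -
    have ab: "a \<in> men G" "b \<in> women G"
      using block by (auto simp: edge_blocks_def edges_eq)
    obtain b' where "(a, b') \<in> level k" using level_covers_man[OF ab(1) k] .
    moreover obtain a' where "(a', b) \<in> level k" using level_covers_woman[OF ab(2) k] .
    ultimately have "Q a b < k" "k < Q a b"
      using block ab unfolding edge_blocks_matching_iff[OF level_matching]
      by (auto simp: man_less_iff woman_less_iff level_def)
    then show False by simp
  qed
  then show ?thesis using level_matching by (auto simp: stable_matchings_def)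
qed

lemma edge_in_stable_matching:
  assumes "e \<in> edges G"
  shows "\<exists>M \<in> stable_matchings G P. e \<in> M"
proof -
  obtain a b where e: "e = (a, b)" "a \<in> men G" "b \<in> women G"
    using assms by (auto simp: edges_eq)
  then have "e \<in> level (Q a b)" "Q a b \<in> {1..n}"
    using entry_bounds by (auto simp: level_def)
  then show ?thesis using level_stable by blast
qed

text \<open>Some edge blocks \<open>M\<close>, and every edge lies in a stable matching. This
  supplies the \<open>dominating\<close> condition for the stable set.\<close>

lemma unstable_blocked_by_stable:
  assumes "matching G M" and "M \<notin> stable_matchings G P"
  obtains N e where "N \<in> stable_matchings G P" and "e \<in> N" and "edge_blocks G P e M"
  using assms edge_in_stable_matching unfolding stable_matchings_def[of G P] by blast

lemma legal_matchings_eq_stable: "legal_matchings G P = stable_matchings G P"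
\<comment> \<open>The empty \<open>S\<close> suffices, since no matching at all blocks a stable
  one.\<close>
proof (rule legal_matchings_eqI[where S = "{}"])
  show "stable_matchings G P \<subseteq> {M. matching G M}" by (auto simp: stable_matchings_def)
  show "\<exists>N\<in>stable_matchings G P. matching_blocks G P N M"
    if "matching G M" "M \<notin> stable_matchings G P" for M
    using unstable_blocked_by_stable[OF that] unfolding matching_blocks_def by metis
qed (use stable_matching_not_blocked in auto)

lemma legal_subgraph_eq: "legal_subgraph G P = G"
proof -
  have "{e \<in> edges G. \<exists>M\<in>legal_matchings G P. e \<in> M} = edges G"
    using edge_in_stable_matching legal_matchings_eq_stable by auto
  then show ?thesis by (simp add: legal_subgraph_def)
qed

section \<open>The extended instance\<close>

definition ext_graph :: "('a option, 'b option) bigraph" where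
  "ext_graph = \<lparr>men = insert None (Some ` men G), women = insert None (Some ` women G),
     edges = map_prod Some Some ` edges G \<union> {None} \<times> insert None (Some ` women G)\<rparr>"

text \<open>Any injection of the finite set of old women into the naturals yields a strict order;
  \<open>Suc\<close> reserves weight 0 for the new woman, who thus comes last.\<close>

definition new_man_weight :: "'b option \<Rightarrow> nat" where
  "new_man_weight y = (case y of None \<Rightarrow> 0
     | Some b \<Rightarrow> Suc ((SOME f :: 'b \<Rightarrow> nat. inj_on f (women G)) b))"

text \<open>Doubling the entries makes room for the new man right below the favourite, whose entry is
  \<open>n\<close>.\<close>

definition ext_woman_weight :: "'b \<Rightarrow> 'a option \<Rightarrow> nat" where
  "ext_woman_weight b x = (case x of None \<Rightarrow> 2 * n - 1 | Some a \<Rightarrow> 2 * Q a b)"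

text \<open>The new woman has a single neighbour, so her strict order is empty; the old men gain no
  neighbour and keep their lists.\<close>

definition ext_prefs :: "('a option, 'b option) prefs" where
  "ext_prefs = \<lparr>
     man_less = (\<lambda>x. case x of
         None \<Rightarrow> {(y', y). y' \<in> women ext_graph \<and> y \<in> women ext_graph \<and>
           new_man_weight y' < new_man_weight y}
       | Some a \<Rightarrow> map_prod Some Some ` man_less P a),
     woman_less = (\<lambda>y. case y of
         None \<Rightarrow> {}
       | Some b \<Rightarrow> {(x', x). x' \<in> men ext_graph \<and> x \<in> men ext_graph \<and>
           ext_woman_weight b x' < ext_woman_weight b x})\<rparr>"

lemma men_ext: "men ext_graph = insert None (Some ` men G)"
  and women_ext: "women ext_graph = insert None (Some ` women G)"
  by (simp_all add: ext_graph_def)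

lemma edges_ext [simp]:
  "(Some a, Some b) \<in> edges ext_graph \<longleftrightarrow> a \<in> men G \<and> b \<in> women G"
  "(Some a, None) \<notin> edges ext_graph"
  "(None, Some b) \<in> edges ext_graph \<longleftrightarrow> b \<in> women G"
  "(None, None) \<in> edges ext_graph"
  by (auto simp: ext_graph_def edges_eq)

lemma inj_on_new_man_weight: "inj_on new_man_weight (women ext_graph)"
proof -
  have "\<exists>f :: 'b \<Rightarrow> nat. inj_on f (women G)"
    using finite_imp_inj_to_nat_seg[OF finite_women] by blast
  then have "inj_on (SOME f :: 'b \<Rightarrow> nat. inj_on f (women G)) (women G)" by (rule someI_ex)
  then show ?thesis by (auto simp: inj_on_def new_man_weight_def women_ext)
qed

lemma inj_on_ext_woman_weight:
  assumes "b \<in> women G"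
  shows "inj_on (ext_woman_weight b) (men ext_graph)"
proof -
  \<comment> \<open>Parity separates the weights: \<open>n\<close> is at least 1 by the entry
    bounds, so \<open>2 * n - 1\<close> is indeed odd.\<close>
  have "2 * Q a b \<noteq> 2 * n - 1" if "a \<in> men G" for a
    using entry_bounds[OF that assms] by presburger
  then show ?thesis
    using inj_on_column[OF assms] by (fastforce simp: inj_on_def ext_woman_weight_def men_ext)
qed

lemma man_less_ext:
  "(y', y) \<in> man_less ext_prefs (Some a) \<longleftrightarrow>
    (\<exists>b' b. y' = Some b' \<and> y = Some b \<and> (b', b) \<in> man_less P a)"
  "(y', y) \<in> man_less ext_prefs None \<longleftrightarrow>
    y' \<in> women ext_graph \<and> y \<in> women ext_graph \<and> new_man_weight y' < new_man_weight y"
  by (auto simp: ext_prefs_def)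

lemma woman_less_ext:
  "(x', x) \<in> woman_less ext_prefs (Some b) \<longleftrightarrow>
    x' \<in> men ext_graph \<and> x \<in> men ext_graph \<and> ext_woman_weight b x' < ext_woman_weight b x"
  "woman_less ext_prefs None = {}"
  by (auto simp: ext_prefs_def)

lemma woman_less_ext_Some:
  assumes "b \<in> women G"
  shows "(Some x', Some x) \<in> woman_less ext_prefs (Some b) \<longleftrightarrow> (x', x) \<in> woman_less P b"
  using assms by (auto simp: woman_less_ext woman_less_iff men_ext ext_woman_weight_def)

lemma sm_instance_ext: "sm_instance ext_graph ext_prefs"
proof -
  have fin: "finite_bigraph ext_graph"
    using finite_men finite_women by (auto simp: finite_bigraph_def ext_graph_def edges_eq)
  have man_None: "man_nbrs ext_graph None = women ext_graph"
    by (auto simp: man_nbrs_def ext_graph_def)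
  have man_Some: "man_nbrs ext_graph (Some a) = Some ` women G" if "a \<in> men G" for a
    using that by (auto simp: man_nbrs_def ext_graph_def edges_eq)
  have woman_None: "woman_nbrs ext_graph None = {None}"
    by (auto simp: woman_nbrs_def ext_graph_def)
  have woman_Some: "woman_nbrs ext_graph (Some b) = men ext_graph" if "b \<in> women G" for b
    using that by (auto simp: woman_nbrs_def ext_graph_def edges_eq)
  have "strict_linear_order_on (Some ` women G) (man_less ext_prefs (Some a))" if "a \<in> men G" for a
    using that inj_on_row[OF that]
    by (auto simp: strict_linear_order_on_def trans_def irrefl_def total_on_def man_less_ext
        man_less_iff inj_on_def) (metis linorder_neqE_nat)
  moreover have "strict_linear_order_on (women ext_graph) (man_less ext_prefs None)"
    using strict_linear_order_on_weight[OF inj_on_new_man_weight] by (simp add: ext_prefs_def)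
  moreover have "strict_linear_order_on (men ext_graph) (woman_less ext_prefs (Some b))"
    if "b \<in> women G" for b
    using strict_linear_order_on_weight[OF inj_on_ext_woman_weight[OF that]] by (simp add: ext_prefs_def)
  moreover have "strict_linear_order_on {None} (woman_less ext_prefs None)"
    by (simp add: woman_less_ext strict_linear_order_on_def trans_def irrefl_def total_on_def)
  ultimately show ?thesis
    unfolding sm_instance_def
    using fin by (auto simp: men_ext women_ext man_None man_Some woman_None woman_Some
        man_less_ext woman_less_ext man_less_iff)
qed

lemma adds_man_and_woman_ext: "adds_man_and_woman G P ext_graph ext_prefs"
  unfolding adds_man_and_woman_def
  by (auto simp: men_ext women_ext edges_eq man_less_ext woman_less_ext_Some)

section \<open>Lifting matchings to the extended instance\<close>

definition lift :: "('a \<times> 'b) set \<Rightarrow> ('a option \<times> 'b option) set" where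
  "lift M = map_prod Some Some ` M \<union> {(None, None)}"

lemma lift_simps [simp]:
  "(Some a, Some b) \<in> lift M \<longleftrightarrow> (a, b) \<in> M"
  "(Some a, None) \<notin> lift M"
  "(None, Some b) \<notin> lift M"
  "(None, None) \<in> lift M"
  by (auto simp: lift_def)

lemma lift_matching_iff: "matching ext_graph (lift M) \<longleftrightarrow> matching G M"
proof -
  have sub: "lift M \<subseteq> edges ext_graph \<longleftrightarrow> M \<subseteq> edges G"
    by (auto simp: lift_def edges_eq)
  show ?thesis
    unfolding matching_def sub split_option_all by simp
qed

text \<open>The added pair leaves the partners of old vertices unchanged, and their preferences
  among old vertices are the original ones.\<close>

lemma lift_edge_blocks_iff:
  assumes "matching G M" and "b \<in> women G"
  shows "edge_blocks ext_graph ext_prefs (Some a, Some b) (lift M) \<longleftrightarrow> edge_blocks G P (a, b) M"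
proof -
  have m: "matching ext_graph (lift M)" using assms(1) by (simp add: lift_matching_iff)
  have "(\<forall>y. (Some a, y) \<in> lift M \<longrightarrow> (y, Some b) \<in> man_less ext_prefs (Some a)) \<longleftrightarrow>
      (\<forall>b'. (a, b') \<in> M \<longrightarrow> (b', b) \<in> man_less P a)"
    by (subst split_option_all) (simp add: man_less_ext)
  moreover have "(\<forall>x. (x, Some b) \<in> lift M \<longrightarrow> (x, Some a) \<in> woman_less ext_prefs (Some b)) \<longleftrightarrow>
      (\<forall>a'. (a', b) \<in> M \<longrightarrow> (a', a) \<in> woman_less P b)"
    by (subst split_option_all) (simp add: woman_less_ext_Some[OF assms(2)])
  ultimately show ?thesis
    unfolding edge_blocks_matching_iff[OF m] edge_blocks_matching_iff[OF assms(1)]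
    by (simp add: edges_eq)
qed

lemma lift_blocks_lift_iff:
  assumes "matching G M" and "matching G N"
  shows "matching_blocks ext_graph ext_prefs (lift N) (lift M) \<longleftrightarrow> matching_blocks G P N M"
proof -
  \<comment> \<open>The new woman is already matched, and her empty preference relation allows no
    improvement.\<close>
  have "\<not> edge_blocks ext_graph ext_prefs (None, None) (lift M)"
    using assms lift_matching_iff[of M] lift_simps(4)[of M]
    by (auto simp: edge_blocks_matching_iff woman_less_ext simp del: lift_simps)
  moreover have "b \<in> women G" if "(a, b) \<in> N" for a b
    using assms(2) that by (auto simp: matching_def edges_eq)
  ultimately show ?thesis
    using lift_edge_blocks_iff[OF assms(1)]
    by (simp add: matching_blocks_def bex_Un lift_def[of N]) (metis map_prod_simp old.prod.exhaust)
qed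

section \<open>Stable and legal matchings of the extended instance\<close>

text \<open>Without women \<open>n\<close> is 0 and lies outside \<open>{1..n}\<close>, so
  \<open>level_stable\<close> does not apply; but then there is no edge to block.\<close>

lemma top_level_stable: "level n \<in> stable_matchings G P"
proof (cases "women G = {}")
  case True
  then have "edges G = {}" by (simp add: edges_eq)
  then show ?thesis using level_matching by (simp add: stable_matchings_def)
next
  case False
  then show ?thesis using top_entry level_stable by blast
qed

text \<open>Each old woman has the man of maximal weight \<open>2 * n\<close>, and the new woman has
  her only neighbour, so no woman can improve.\<close>

lemma lift_top_level_stable: "lift (level n) \<in> stable_matchings ext_graph ext_prefs"
proof -
  have m: "matching ext_graph (lift (level n))" by (simp add: lift_matching_iff level_matching)
  have "\<not> edge_blocks ext_graph ext_prefs (x, y) (lift (level n))" for x y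
  proof (cases y)
    case None
    then show ?thesis
      using lift_simps(4)[of "level n"]
      by (cases x) (auto simp: edge_blocks_matching_iff[OF m] woman_less_ext simp del: lift_simps)
  next
    case (Some b)
    show ?thesis
    proof
      assume block: "edge_blocks ext_graph ext_prefs (x, y) (lift (level n))"
      then have b: "b \<in> women G"
        using Some by (cases x) (auto simp: edge_blocks_def)
      obtain a where a: "(a, b) \<in> level n"
        using level_covers_woman[OF b top_entry(2)[OF b]] .
      then have "(Some a, x) \<in> woman_less ext_prefs (Some b)"
        using block Some by (auto simp: edge_blocks_matching_iff[OF m])
      then show False
        using a entry_bounds[OF _ b]
        by (auto simp: woman_less_ext men_ext ext_woman_weight_def level_def not_less[symmetric])
    qed
  qed
  then show ?thesis using m by (auto simp: stable_matchings_def)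
qed

lemma unblocked_is_lift:
  assumes N: "matching ext_graph N"
    and unblocked: "\<not> matching_blocks ext_graph ext_prefs (lift (level n)) N"
  obtains M where "matching G M" and "N = lift M"
proof -
  have N_edges: "N \<subseteq> edges ext_graph"
    and N_man: "\<And>x y y'. (x, y) \<in> N \<Longrightarrow> (x, y') \<in> N \<Longrightarrow> y = y'"
    and N_woman: "\<And>x x' y. (x, y) \<in> N \<Longrightarrow> (x', y) \<in> N \<Longrightarrow> x = x'"
    using N unfolding matching_def by blast+
  have covers: "\<exists>y \<in> women ext_graph. (x, y) \<in> N" if x: "x \<in> men ext_graph" for x
  proof (rule ccontr)
    assume "\<not> (\<exists>y \<in> women ext_graph. (x, y) \<in> N)"
    then have single: "(x, y) \<notin> N" for y
      using N_edges by (auto simp: ext_graph_def edges_eq)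
    have "\<exists>e \<in> lift (level n). edge_blocks ext_graph ext_prefs e N"
    proof (cases x)
      case None
      \<comment> \<open>The only neighbour of the new woman is the new man, so she is unmatched as
        well.\<close>
      have "(x', None) \<notin> N" for x'
        using N_edges single None by (cases x') auto
      then have "edge_blocks ext_graph ext_prefs (None, None) N"
        using single None by (simp add: edge_blocks_matching_iff[OF N])
      then show ?thesis using lift_simps(4) by blast
    next
      case (Some a)
      then have a: "a \<in> men G" using x by (auto simp: men_ext)
      \<comment> \<open>This also makes \<open>n\<close> positive, so the new man's weight
        \<open>2 * n - 1\<close> is strictly below \<open>2 * n\<close>.\<close>
      then have "n \<in> {1..n}" by (rule top_entry)
      then obtain b where b: "(a, b) \<in> level n" using level_covers_man a by blast
      then have bw: "b \<in> women G" and Qn: "Q a b = n" by (auto simp: level_def)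
      have "(x', Some a) \<in> woman_less ext_prefs (Some b)" if x': "(x', Some b) \<in> N" for x'
      proof (cases x')
        case None
        then show ?thesis using Qn a \<open>n \<in> {1..n}\<close>
          by (auto simp: woman_less_ext ext_woman_weight_def men_ext)
      next
        case (Some a')
        then have a': "a' \<in> men G" "a' \<noteq> a" using x' single \<open>x = Some a\<close> N_edges by auto
        then have "Q a' b \<noteq> Q a b" using inj_on_column[OF bw] a by (auto simp: inj_on_def)
        then show ?thesis using Some a a' bw Qn entry_bounds[OF a'(1) bw]
          by (auto simp: woman_less_ext ext_woman_weight_def men_ext)
      qed
      then have "edge_blocks ext_graph ext_prefs (Some a, Some b) N"
        using single Some a bw by (simp add: edge_blocks_matching_iff[OF N])
      then show ?thesis using b lift_simps(1) by blast
    qed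
    then show False using unblocked by (auto simp: matching_blocks_def)
  qed
  \<comment> \<open>Choosing partners gives an injection of the men into the women; both sides have
    equally many members, so it is onto and reaches the new woman.\<close>
  then obtain w where w: "\<And>x. x \<in> men ext_graph \<Longrightarrow> w x \<in> women ext_graph \<and> (x, w x) \<in> N"
    by metis
  have "inj_on w (men ext_graph)"
    using w N_woman by (metis inj_onI)
  then have "card (w ` men ext_graph) = card (women ext_graph)"
    using square finite_men finite_women
    by (simp add: card_image men_ext women_ext latin_square_def)
  moreover have "w ` men ext_graph \<subseteq> women ext_graph" using w by blast
  ultimately have "w ` men ext_graph = women ext_graph"
    using finite_women by (intro card_subset_eq) (auto simp: women_ext)
  then have "None \<in> w ` men ext_graph" by (simp add: women_ext)
  then obtain x where "x \<in> men ext_graph" "w x = None" by auto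
  then have "(x, None) \<in> N" using w by metis
  \<comment> \<open>Her partner can only be the new man.\<close>
  then have new: "(None, None) \<in> N" using N_edges by (cases x) auto
  define M where "M = {(a, b). (Some a, Some b) \<in> N}"
  have "(x, y) \<in> N \<longleftrightarrow> (x, y) \<in> lift M" for x y
    using new N_man[OF new] N_edges by (cases x; cases y) (auto simp: M_def)
  then have "N = lift M" by auto
  then show thesis using that N lift_matching_iff by blast
qed

lemma legal_matchings_ext: "legal_matchings ext_graph ext_prefs = lift ` stable_matchings G P"
\<comment> \<open>The other lifts are not stable in the extension, so \<open>S\<close> contains only
  this one; it already blocks every matching that is not a lift.\<close>
proof (rule legal_matchings_eqI[where S = "{lift (level n)}"])
  have stable_matching: "matching G M" if "M \<in> stable_matchings G P" for M
    using that by (simp add: stable_matchings_def)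
  show "lift ` stable_matchings G P \<subseteq> {M. matching ext_graph M}"
    using stable_matching by (auto simp: lift_matching_iff)
  show "{lift (level n)} \<subseteq> stable_matchings ext_graph ext_prefs"
    using lift_top_level_stable by simp
  show "{lift (level n)} \<subseteq> lift ` stable_matchings G P"
    using top_level_stable by simp
  show "\<not> matching_blocks ext_graph ext_prefs N M"
    if M: "M \<in> lift ` stable_matchings G P" and N: "matching ext_graph N"
      and unblocked: "\<And>R. R \<in> {lift (level n)} \<Longrightarrow> \<not> matching_blocks ext_graph ext_prefs R N"
    for M N
  proof -
    obtain N' where "matching G N'" "N = lift N'"
      using unblocked_is_lift[OF N] unblocked by blast
    then show ?thesis
      using M stable_matching stable_matching_not_blocked lift_blocks_lift_iff by blast
  qed
  show "\<exists>N \<in> lift ` stable_matchings G P. matching_blocks ext_graph ext_prefs N M"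
    if M: "matching ext_graph M" "M \<notin> lift ` stable_matchings G P" for M
  proof (cases "matching_blocks ext_graph ext_prefs (lift (level n)) M")
    case True
    then show ?thesis using top_level_stable by blast
  next
    case False
    then obtain M' where M': "matching G M'" "M = lift M'"
      using unblocked_is_lift[OF M(1)] by blast
    \<comment> \<open>\<open>M'\<close> is unstable, since otherwise \<open>M\<close> would be the
      lift of a stable matching.\<close>
    then obtain N e where N: "N \<in> stable_matchings G P" "e \<in> N" "edge_blocks G P e M'"
      using unstable_blocked_by_stable[of M'] M(2) by blast
    then have "matching_blocks G P N M'" unfolding matching_blocks_def by blast
    then show ?thesis
      using M' N(1) stable_matching lift_blocks_lift_iff by blast
  qed
qed

text \<open>In a lift the new man has his last choice, so he blocks with any woman lacking her
  favourite. Stability thus forces the top level.\<close>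

lemma stable_matchings_ext: "stable_matchings ext_graph ext_prefs = {lift (level n)}"
proof
  show "{lift (level n)} \<subseteq> stable_matchings ext_graph ext_prefs"
    using lift_top_level_stable by simp
  show "stable_matchings ext_graph ext_prefs \<subseteq> {lift (level n)}"
  proof
    fix N assume N: "N \<in> stable_matchings ext_graph ext_prefs"
    then have mN: "matching ext_graph N" by (simp add: stable_matchings_def)
    have "\<not> matching_blocks ext_graph ext_prefs (lift (level n)) N"
      using stable_matching_not_blocked[OF N] by (simp add: lift_matching_iff level_matching)
    then obtain M where M: "matching G M" "N = lift M" using unblocked_is_lift[OF mN] by blast
    have top: "\<exists>a. (a, b) \<in> M \<and> (a, b) \<in> level n" if b: "b \<in> women G" for b
    proof (rule ccontr)
      assume no_top: "\<not> ?thesis"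
      have "(x, None) \<in> woman_less ext_prefs (Some b)" if x: "(x, Some b) \<in> lift M" for x
      proof (cases x)
        case None
        then show ?thesis using x by simp
      next
        case (Some a)
        then have ab: "(a, b) \<in> M" "a \<in> men G" using x M(1) by (auto simp: matching_def edges_eq)
        then have "Q a b \<noteq> n" using no_top b by (auto simp: level_def)
        then have "Q a b < n" using entry_bounds[OF ab(2) b] by simp
        then show ?thesis
          using Some ab by (auto simp: woman_less_ext men_ext ext_woman_weight_def)
      qed
      \<comment> \<open>The new man's partner in a lift is the new woman, whose weight 0 lies below
        every \<open>Suc\<close> value.\<close>
      moreover have "(y, Some b) \<in> man_less ext_prefs None" if "(None, y) \<in> lift M" for y
        using that b by (cases y) (auto simp: man_less_ext women_ext new_man_weight_def)
      ultimately have "edge_blocks ext_graph ext_prefs (None, Some b) N"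
        using b M by (simp add: edge_blocks_matching_iff lift_matching_iff)
      then show False
        using N b unfolding stable_matchings_def by (auto dest: bspec[where x = "(None, Some b)"])
    qed
    have "(a, b) \<in> M \<longleftrightarrow> (a, b) \<in> level n" for a b
    proof (cases "b \<in> women G")
      case True
      \<comment> \<open>\<open>M\<close> and \<open>level n\<close> share an edge at
        \<open>b\<close>, and neither has another one there.\<close>
      then obtain a' where "(a', b) \<in> M" "(a', b) \<in> level n" using top by blast
      then show ?thesis using M(1) level_matching[of n] unfolding matching_def by metis
    next
      case False
      then show ?thesis using M(1) by (auto simp: level_def matching_def edges_eq)
    qed
    then have "M = level n" by auto
    then show "N \<in> {lift (level n)}" using M(2) by simp
  qed
qed

end

theorem theorem11:
  fixes G :: "('a, 'b) bigraph" and P :: "('a, 'b) prefs" and n :: nat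
  assumes "latin_instance G P n"
  shows "legal_subgraph G P = G \<and>
    (\<exists>(G' :: ('a option, 'b option) bigraph) (P' :: ('a option, 'b option) prefs).
        sm_instance G' P' \<and>
        adds_man_and_woman G P G' P' \<and>
        card (stable_matchings G' P') = 1 \<and>
        legal_matchings G' P' =
          {map_prod Some Some ` M \<union> {(None, None)} | M. M \<in> stable_matchings G P})"
proof -
  obtain Q where "latin_setup G P n Q"
    using assms unfolding latin_instance_def latin_setup_def by blast
  then interpret latin_setup G P n Q .
  have "legal_matchings ext_graph ext_prefs =
      {map_prod Some Some ` M \<union> {(None, None)} | M. M \<in> stable_matchings G P}"
    by (auto simp: legal_matchings_ext lift_def)
  moreover have "card (stable_matchings ext_graph ext_prefs) = 1"
    by (simp add: stable_matchings_ext)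
  ultimately show ?thesis
    using legal_subgraph_eq sm_instance_ext adds_man_and_woman_ext by blast
qed

end
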